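(* Let $M\in\mathbb{R}^{n\times n}$, $Q\in\mathbb{R}^{n\times m}$, $A\in\mathbb{R}^{p\times n}$, $B\in\mathbb{R}^{p\times m}$, $r\in\mathbb{R}^n$, $b\in\mathbb{R}^p$. Let $(c_x^*,c_z^*,x^*,z^*,u^*,v^* )$ be a global minimizer of the bilinear optimization problem $$\begin{aligned}\min\ & c_x^Tx+c_z^Tz-r^Tu-b^Tv\\ \text{s.t.}\ & Mx+Qz\ge r,\ \ Ax+Bz=b,\\ & M^Tu+A^Tv\le c_x,\ \ Q^Tu+B^Tv=c_z,\\ & x\le u,\ \ x,z,u\ge 0,\ \ v\text{ free},\end{aligned}$$ in the decision variables $(c_x,c_z,x,z,u,v)$. If $$(c_x^* )^Tx^*+(c_z^* )^Tz^*-r^Tu^*-b^Tv^*=0,$$ then $(x^*,z^* )\in\mathcal{X}_{\mathrm{SLCC}}$; otherwise, $\mathcal{X}_{\mathrm{SLCC}}=\varnothing$.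
   Context: $\mathcal{X}_{\mathrm{SLCC}}$ is the set of all $(x,z)\in\mathbb{R}^n\times\mathbb{R}^m$ with $$Mx+Qz-r\ge 0,\quad Ax+Bz=b,\quad x^T(Mx+Qz-r)=0,\quad x,z\ge 0.$$ Vector inequalities are component-wise; in the bilinear problem $c_x\in\mathbb{R}^n$, $c_z\in\mathbb{R}^m$, $u\in\mathbb{R}^n$, $v\in\mathbb{R}^p$. *)

theory Defs
  imports "HOL-Analysis.Analysis"
begin

text \<open>The order on \<open>real ^ 'n\<close> is the component-wise one (\<open>less_eq_vec_def\<close>), and an
  \<open>n \<times> m\<close> matrix has type \<open>real ^ 'm ^ 'n\<close>.\<close>

definition X_SLCC ::
  "real ^ 'n ^ 'n \<Rightarrow> real ^ 'm ^ 'n \<Rightarrow> real ^ 'n ^ 'p \<Rightarrow> real ^ 'm ^ 'p \<Rightarrow> real ^ 'n \<Rightarrow> real ^ 'p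
    \<Rightarrow> ((real ^ 'n) \<times> (real ^ 'm)) set" where
  "X_SLCC M Q A B r b =
    {(x, z). M *v x + Q *v z - r \<ge> 0 \<and> A *v x + B *v z = b \<and>
             x \<bullet> (M *v x + Q *v z - r) = 0 \<and> x \<ge> 0 \<and> z \<ge> 0}"

definition bilinear_feasible ::
  "real ^ 'n ^ 'n \<Rightarrow> real ^ 'm ^ 'n \<Rightarrow> real ^ 'n ^ 'p \<Rightarrow> real ^ 'm ^ 'p \<Rightarrow> real ^ 'n \<Rightarrow> real ^ 'p
    \<Rightarrow> ((real ^ 'n) \<times> (real ^ 'm) \<times> (real ^ 'n) \<times> (real ^ 'm) \<times> (real ^ 'n) \<times> (real ^ 'p)) set" where
  "bilinear_feasible M Q A B r b =
    {(cx, cz, x, z, u, v).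
       M *v x + Q *v z \<ge> r \<and> A *v x + B *v z = b \<and>
       transpose M *v u + transpose A *v v \<le> cx \<and>
       transpose Q *v u + transpose B *v v = cz \<and>
       x \<le> u \<and> x \<ge> 0 \<and> z \<ge> 0 \<and> u \<ge> 0}"

definition bilinear_objective ::
  "real ^ 'n \<Rightarrow> real ^ 'p
    \<Rightarrow> (real ^ 'n) \<times> (real ^ 'm) \<times> (real ^ 'n) \<times> (real ^ 'm) \<times> (real ^ 'n) \<times> (real ^ 'p) \<Rightarrow> real" where
  "bilinear_objective r b = (\<lambda>(cx, cz, x, z, u, v). cx \<bullet> x + cz \<bullet> z - r \<bullet> u - b \<bullet> v)"

end

theory Submission
  imports Defs
begin

text \<open>For fixed costs \<open>(c\<^sub>x, c\<^sub>z)\<close> the objective is the gap between the value of a linear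
  program at \<open>(x, z)\<close> and that of its dual at \<open>(u, v)\<close>, where \<open>z\<close> has equality dual constraints. Writing
  \<open>s = M x + Q z - r\<close> for the primal slack, the gap is a sum of the dual slack paired with \<open>x\<close>,
  of \<open>(u - x) \<bullet> s\<close>, and of the complementarity term \<open>x \<bullet> s\<close> (lemma \<open>bilinear_objective_split\<close>).
  On the feasible set all three summands are nonnegative, the second because of the constraint
  \<open>x \<le> u\<close>. Hence the objective bounds \<open>x \<bullet> s \<ge> 0\<close> from above, and a feasible point with objective
  zero is complementary (lemma \<open>complementarity_le_bilinear_objective\<close>).

  Conversely a point of \<open>X_SLCC\<close> is its own dual certificate: with \<open>u = x\<close>, \<open>v = 0\<close> and costs chosen
  so that the dual constraints are tight, the first two summands vanish, and complementarity
  makes the third vanish too (lemma \<open>X_SLCC_zero_objective\<close>). So as soon as \<open>X_SLCC\<close> is nonempty,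
  the minimum is zero.\<close>

text \<open>The two equality constraints are what keeps \<open>B\<close>, \<open>b\<close> and \<open>c\<^sub>z\<close> out of the right-hand side:
  once the transposes are moved across the inner products, \<open>c\<^sub>z \<bullet> z\<close> supplies the terms
  \<open>u \<bullet> Q z\<close> and \<open>v \<bullet> B z\<close>, and \<open>b \<bullet> v\<close> cancels \<open>v \<bullet> (A x + B z)\<close>.\<close>

lemma bilinear_objective_split:
  fixes M :: "real ^ 'n ^ 'n" and Q :: "real ^ 'm ^ 'n"
    and A :: "real ^ 'n ^ 'p" and B :: "real ^ 'm ^ 'p"
  assumes "A *v x + B *v z = b" and "transpose Q *v u + transpose B *v v = cz"
  shows "bilinear_objective r b (cx, cz, x, z, u, v) =
    (cx - (transpose M *v u + transpose A *v v)) \<bullet> x +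
    (u - x) \<bullet> (M *v x + Q *v z - r) + x \<bullet> (M *v x + Q *v z - r)"
  unfolding bilinear_objective_def assms[symmetric]
  by (simp add: algebra_simps inner_commute[of x] inner_commute[of z]
      inner_commute[of u r] inner_commute[of _ v] dot_lmul_matrix)

lemma complementarity_le_bilinear_objective:
  assumes "(cx, cz, x, z, u, v) \<in> bilinear_feasible M Q A B r b"
  shows "0 \<le> x \<bullet> (M *v x + Q *v z - r)"
    and "x \<bullet> (M *v x + Q *v z - r) \<le> bilinear_objective r b (cx, cz, x, z, u, v)"
proof -
  let ?s = "M *v x + Q *v z - r"
  have s: "0 \<le> ?s" and x: "0 \<le> x" and u: "0 \<le> u - x"
    and dual: "0 \<le> cx - (transpose M *v u + transpose A *v v)"
    and eqs: "A *v x + B *v z = b" "transpose Q *v u + transpose B *v v = cz"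
    using assms by (auto simp: bilinear_feasible_def)
  show "0 \<le> x \<bullet> ?s"
    using x s by (rule inner_nonneg_nonneg)
  show "x \<bullet> ?s \<le> bilinear_objective r b (cx, cz, x, z, u, v)"
    unfolding bilinear_objective_split[OF eqs, of r cx M]
    using inner_nonneg_nonneg[OF dual x] inner_nonneg_nonneg[OF u s] by simp
qed

lemma X_SLCC_zero_objective:
  assumes "(x, z) \<in> X_SLCC M Q A B r b"
  defines "w \<equiv> (transpose M *v x, transpose Q *v x, x, z, x, 0)"
  shows "w \<in> bilinear_feasible M Q A B r b" and "bilinear_objective r b w = 0"
proof -
  show "w \<in> bilinear_feasible M Q A B r b"
    using assms by (auto simp: X_SLCC_def bilinear_feasible_def)
  have "A *v x + B *v z = b" and "x \<bullet> (M *v x + Q *v z - r) = 0"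
    using assms by (auto simp: X_SLCC_def)
  then show "bilinear_objective r b w = 0"
    unfolding w_def by (simp add: bilinear_objective_split[of A x B z b Q x 0 _ r _ M])
qed

theorem proposition4p2:
  fixes M :: "real ^ 'n ^ 'n" and Q :: "real ^ 'm ^ 'n"
    and A :: "real ^ 'n ^ 'p" and B :: "real ^ 'm ^ 'p"
    and r :: "real ^ 'n" and b :: "real ^ 'p"
    and cx x u :: "real ^ 'n" and cz z :: "real ^ 'm" and v :: "real ^ 'p"
  assumes "is_arg_min (bilinear_objective r b)
             (\<lambda>w. w \<in> bilinear_feasible M Q A B r b) (cx, cz, x, z, u, v)"
  shows "(cx \<bullet> x + cz \<bullet> z - r \<bullet> u - b \<bullet> v = 0 \<longrightarrow> (x, z) \<in> X_SLCC M Q A B r b) \<and>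
         (cx \<bullet> x + cz \<bullet> z - r \<bullet> u - b \<bullet> v \<noteq> 0 \<longrightarrow> X_SLCC M Q A B r b = {})"
proof (intro conjI impI)
  have feas: "(cx, cz, x, z, u, v) \<in> bilinear_feasible M Q A B r b"
    and le: "\<And>w. w \<in> bilinear_feasible M Q A B r b \<Longrightarrow>
      bilinear_objective r b (cx, cz, x, z, u, v) \<le> bilinear_objective r b w"
    using assms by (auto simp: is_arg_min_linorder)
  have obj: "bilinear_objective r b (cx, cz, x, z, u, v) = cx \<bullet> x + cz \<bullet> z - r \<bullet> u - b \<bullet> v"
    by (simp add: bilinear_objective_def)
  note bounds = complementarity_le_bilinear_objective[OF feas, unfolded obj]
  {
    assume "cx \<bullet> x + cz \<bullet> z - r \<bullet> u - b \<bullet> v = 0"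
    then have "x \<bullet> (M *v x + Q *v z - r) = 0"
      using bounds by linarith
    then show "(x, z) \<in> X_SLCC M Q A B r b"
      using feas by (auto simp: X_SLCC_def bilinear_feasible_def)
  next
    assume nonzero: "cx \<bullet> x + cz \<bullet> z - r \<bullet> u - b \<bullet> v \<noteq> 0"
    show "X_SLCC M Q A B r b = {}"
    proof (rule ccontr)
      assume "X_SLCC M Q A B r b \<noteq> {}"
      then obtain x' z' where sol: "(x', z') \<in> X_SLCC M Q A B r b"
        by auto
      have "cx \<bullet> x + cz \<bullet> z - r \<bullet> u - b \<bullet> v \<le> 0"
        using le[OF X_SLCC_zero_objective(1)[OF sol]] X_SLCC_zero_objective(2)[OF sol]
        unfolding obj by linarith
      with bounds nonzero show False by linarith
    qed
  }
qed

end
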